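(* Let $\mathcal{M}$ be a metric space whose underlying set is $\omega$, and let $\mathcal{C}(\mathcal{M})$ be its metric completion. Suppose $\mathcal{C}(\mathcal{M})$ is rigid, i.e. it has no nontrivial $\mathscr{U}$-automorphism (equivalently, no nontrivial bijective self-isometry). Then $\mathrm{SR}(\mathcal{C}(\mathcal{M})) < \omega_1^{\mathcal{M}}$.
   Context: The language of metric spaces is $\mathscr{U} = \{\dot d_q, \dot d^q : q \in \mathbb{Q}^+\}$ with binary relation symbols, interpreted in a metric space by $\dot d_q(x,y) \Leftrightarrow d(x,y) < q$ and $\dot d^q(x,y) \Leftrightarrow d(x,y) > q$. For a structure $\mathcal{N}$ and tuples $\bar a=(a_0,\dots,a_{p-1})$, $\bar b=(b_0,\dots,b_{p-1})$ from $\mathcal{N}$ of equal length: $\bar a \sim_0 \bar b$ iff $a_i\mapsto b_i$ ($i<p$) is a partial $\mathscr{U}$-isomorphism; $\bar a \sim_{\alpha+1}\bar b$ iff for every $a\in\mathcal{N}$ there is $b\in\mathcal{N}$ with $\bar a a\sim_\alpha \bar b b$ and for every $b\in \mathcal{N}$ there is $a\in\mathcal{N}$ with $\bar a a\sim_\alpha\bar b b$; for limit $\beta$, $\bar a\sim_\beta\bar b$ iff $\bar a\sim_\alpha\bar b$ for all $\alpha<\beta$. $\mathrm{SR}(\bar a,\bar b)$ is the least ordinal $\mu$ with $\neg(\bar a\sim_\mu\bar b)$, or $\infty$ if none exists. $\mathrm{SR}(\bar a)=\sup\{\mathrm{SR}(\bar a,\bar b): \bar b\in {}^{|\bar a|}\mathcal{N},\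 \mathrm{SR}(\bar a,\bar b)\neq\infty\}$ and $\mathrm{SR}(\mathcal{N})=\sup\{\mathrm{SR}(\bar a)+1:\bar a\in{}^{<\omega}\mathcal{N}\}$. The metric space $\mathcal{M}$ on $\omega$ is regarded as a real (subset of $\omega$) by coding the interpretations of all symbols of $\mathscr{U}$ in a fixed recursive way. For a real $x$, $\omega_1^x$ is the least ordinal $\alpha$ with $L_\alpha(x)\models\mathsf{KP}$ (equivalently, the least ordinal that is not the order type of a well-ordering of $\omega$ computable from $x$). *)

theory Defs
  imports "HOL-Analysis.Analysis" "HOL-Library.Nat_Bijection"
begin

text \<open>recfn X n f: f, viewed as a function on argument lists of length n, is a total
  recursive function relative to the oracle X (Kleene: basic functions + oracle,
  closed under composition, primitive recursion and regular minimisation).\<close>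

inductive recfn :: "(nat \<Rightarrow> bool) \<Rightarrow> nat \<Rightarrow> (nat list \<Rightarrow> nat) \<Rightarrow> bool" for X where
  zero: "recfn X n (\<lambda>xs. 0)"
| succ: "recfn X 1 (\<lambda>xs. Suc (xs ! 0))"
| proj: "i < n \<Longrightarrow> recfn X n (\<lambda>xs. xs ! i)"
| orac: "recfn X 1 (\<lambda>xs. if X (xs ! 0) then 1 else 0)"
| comp: "recfn X m g \<Longrightarrow> (\<And>i. i < m \<Longrightarrow> recfn X n (hs i)) \<Longrightarrow>
         recfn X n (\<lambda>xs. g (map (\<lambda>i. hs i xs) [0..<m]))"
| prim: "recfn X n g \<Longrightarrow> recfn X (Suc (Suc n)) h \<Longrightarrow>
         recfn X (Suc n) (\<lambda>xs. rec_nat (g (tl xs)) (\<lambda>y r. h (y # r # tl xs)) (hd xs))"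
| mu: "recfn X (Suc n) g \<Longrightarrow> (\<And>xs. length xs = n \<Longrightarrow> \<exists>y. g (y # xs) = 0) \<Longrightarrow>
       recfn X n (\<lambda>xs. LEAST y. g (y # xs) = 0)"

definition computable_in :: "(nat \<Rightarrow> bool) \<Rightarrow> (nat \<times> nat) set \<Rightarrow> bool" where
  "computable_in X W \<longleftrightarrow>
     (\<exists>f. recfn X 2 f \<and> (\<forall>a b. f [a, b] = (if (a, b) \<in> W then 1 else 0)))"

text \<open>The symbol \<open>d_q\<close> / \<open>d^q\<close> with q = (p+1)/(r+1) and t = 0 / t = 1 holding of (m,n)
  is coded by the number prod_encode (t, prod_encode (p, prod_encode (r, prod_encode (m, n)))).\<close>
definition metric_code :: "(nat \<Rightarrow> nat \<Rightarrow> real) \<Rightarrow> nat \<Rightarrow> bool" where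
  "metric_code d c \<longleftrightarrow>
     (\<exists>t p r m n. c = prod_encode (t, prod_encode (p, prod_encode (r, prod_encode (m, n)))) \<and>
        ((t = 0 \<and> d m n < real (Suc p) / real (Suc r)) \<or>
         (t = 1 \<and> d m n > real (Suc p) / real (Suc r))))"

definition U_automorphism :: "('a::metric_space \<Rightarrow> 'a) \<Rightarrow> bool" where
  "U_automorphism g \<longleftrightarrow> bij g \<and>
     (\<forall>x y. \<forall>q::rat. q > 0 \<longrightarrow>
        (dist (g x) (g y) < of_rat q \<longleftrightarrow> dist x y < of_rat q) \<and>
        (dist (g x) (g y) > of_rat q \<longleftrightarrow> dist x y > of_rat q))"

definition U_rigid :: "'a::metric_space itself \<Rightarrow> bool" where
  "U_rigid _ \<longleftrightarrow> (\<forall>g::'a \<Rightarrow> 'a. U_automorphism g \<longrightarrow> g = id)"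

definition partial_U_iso :: "'a::metric_space list \<Rightarrow> 'a list \<Rightarrow> bool" where
  "partial_U_iso as bs \<longleftrightarrow> length as = length bs \<and>
     (\<forall>i < length as. \<forall>j < length as.
        (as ! i = as ! j \<longleftrightarrow> bs ! i = bs ! j) \<and>
        (\<forall>q::rat. q > 0 \<longrightarrow>
           (dist (as ! i) (as ! j) < of_rat q \<longleftrightarrow> dist (bs ! i) (bs ! j) < of_rat q) \<and>
           (dist (as ! i) (as ! j) > of_rat q \<longleftrightarrow> dist (bs ! i) (bs ! j) > of_rat q)))"

text \<open>Ordinals are represented by well-orders: for a well-order W and i in its field,
  the ordinal is the order type of the strict initial segment below i.
  bf_rel W i is \<sim>_\<alpha> for that ordinal \<alpha>, defined by well-founded recursion along W
  with the zero / successor / limit clauses.\<close>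

definition back_forth :: "('a list \<times> 'a list) set \<Rightarrow> ('a list \<times> 'a list) set" where
  "back_forth R = {(as, bs). (\<forall>a. \<exists>b. (as @ [a], bs @ [b]) \<in> R) \<and>
                             (\<forall>b. \<exists>a. (as @ [a], bs @ [b]) \<in> R)}"

definition immediate_pred :: "'i rel \<Rightarrow> 'i \<Rightarrow> 'i \<Rightarrow> bool" where
  "immediate_pred W j i \<longleftrightarrow> (j, i) \<in> W \<and> j \<noteq> i \<and>
     \<not> (\<exists>k. (j, k) \<in> W \<and> j \<noteq> k \<and> (k, i) \<in> W \<and> k \<noteq> i)"

definition bf_step :: "'i rel \<Rightarrow> ('i \<Rightarrow> ('a::metric_space list \<times> 'a list) set) \<Rightarrow> 'i
    \<Rightarrow> ('a list \<times> 'a list) set" where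
  "bf_step W R i =
     (if \<not> (\<exists>j. (j, i) \<in> W \<and> j \<noteq> i) then {(as, bs). partial_U_iso as bs}
      else if (\<exists>j. immediate_pred W j i) then back_forth (R (THE j. immediate_pred W j i))
      else {(as, bs). length as = length bs \<and> (\<forall>j. (j, i) \<in> W \<and> j \<noteq> i \<longrightarrow> (as, bs) \<in> R j)})"

definition bf_rel :: "'i rel \<Rightarrow> 'i \<Rightarrow> ('a::metric_space list \<times> 'a list) set" where
  "bf_rel W = wfrec (W - Id) (bf_step W)"

text \<open>SR(as,bs) \<noteq> \<infinity>: some ordinal \<mu> has \<not> as \<sim>_\<mu> bs. Ordinals are here represented by
  well-orders on the (large) type \<open>'a list set\<close>; every ordinal of cardinality at most
  2^|'a| is of this form, which covers all ordinals where \<sim>_\<mu> can change.\<close>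
definition SR_pair_finite :: "'a::metric_space list \<Rightarrow> 'a list \<Rightarrow> bool" where
  "SR_pair_finite as bs \<longleftrightarrow>
     (\<exists>V :: ('a list set) rel. Well_order V \<and> (\<exists>k \<in> Field V. (as, bs) \<notin> bf_rel V k))"

definition SR_tuple_le :: "'i rel \<Rightarrow> 'i \<Rightarrow> 'a::metric_space list \<Rightarrow> bool" where
  "SR_tuple_le W j as \<longleftrightarrow>
     (\<forall>bs. length bs = length as \<longrightarrow> SR_pair_finite as bs \<longrightarrow>
        (\<exists>k. (k, j) \<in> W \<and> (as, bs) \<notin> bf_rel W k))"

text \<open>SR(N) \<le> \<alpha>_i, i.e. SR(as) + 1 \<le> \<alpha>_i for every finite tuple as.\<close>
definition SR_structure_le :: "'a::metric_space itself \<Rightarrow> 'i rel \<Rightarrow> 'i \<Rightarrow> bool" where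
  "SR_structure_le _ W i \<longleftrightarrow>
     (\<forall>as :: 'a list. \<exists>j. (j, i) \<in> W \<and> j \<noteq> i \<and> SR_tuple_le W j as)"

definition SR_below_omega1 :: "'a::metric_space itself \<Rightarrow> (nat \<Rightarrow> bool) \<Rightarrow> bool" where
  "SR_below_omega1 T X \<longleftrightarrow>
     (\<exists>W :: (nat \<times> nat) set. Well_order W \<and> computable_in X W \<and>
        (\<exists>i \<in> Field W. SR_structure_le T W i))"

end

theory Submission
  imports Defs
begin

text \<open>
  No boundedness theorem is needed: rigidity itself says that a certain tree is well-founded. The
  branches of the tree describe the non-identity automorphisms of the completion, as sequences of
  better and better approximations by points of the dense set to the images and preimages of the
  dense points. The tree is computable in the metric, so by rigidity its Kleene--Brouwer order is a
  computable well-order. If two distinct tuples are back-and-forth equivalent at the level given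
  by a node that approximates them, then one back-and-forth step extends the tuples and leads to
  a child of the node, which is smaller in the Kleene--Brouwer order. Hence distinct tuples are
  already separated at the level given by the root.
\<close>

section \<open>Functions recursive in an oracle\<close>

text \<open>The completion may be uncountable, so nodes listing actual points and their images
  cannot be numbers, and the oracle decides only comparisons of distances between dense points with
  rationals. This forces approximations, and with them tolerances that must work in both directions:
  the tests must force convergence and equality of distances in the limit, yet be passed by every
  close enough approximation of a true isometric family. Hence the slack of one grid step in
  \<open>stage\<close> and the factor 4 in \<open>1 / (4 * real (Suc k))\<close>. Preimages are
  recorded beside images to make the limit isometry onto.

  The level that separates two tuples must not depend on them. Whatever depends on them, namely
  which dense point is moved and how far, is stored in the second entry \<open>c\<close>, and all
  nodes \<open>[0, c]\<close> lie below the single node \<open>[0]\<close>.\<close>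

definition pfst :: "nat \<Rightarrow> nat" where "pfst z = fst (prod_decode z)"
definition psnd :: "nat \<Rightarrow> nat" where "psnd z = snd (prod_decode z)"
abbreviation pr :: "nat \<Rightarrow> nat \<Rightarrow> nat" where "pr m n \<equiv> prod_encode (m, n)"

lemma pfst_pr [simp]: "pfst (pr m n) = m" by (simp add: pfst_def)
lemma psnd_pr [simp]: "psnd (pr m n) = n" by (simp add: psnd_def)

text \<open>\<open>recfn\<close> fixes values on lists of every length and is not closed under
  changing them on lists of the wrong length; this is its closure under such changes.\<close>

definition rec_in :: "(nat \<Rightarrow> bool) \<Rightarrow> nat \<Rightarrow> (nat list \<Rightarrow> nat) \<Rightarrow> bool" where
  "rec_in X n f \<longleftrightarrow> (\<exists>h. recfn X n h \<and> (\<forall>xs. length xs = n \<longrightarrow> h xs = f xs))"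

lemma rec_in_cong: "rec_in X n f \<Longrightarrow> (\<And>xs. length xs = n \<Longrightarrow> f xs = g xs) \<Longrightarrow> rec_in X n g"
  unfolding rec_in_def by auto

lemma rec_in_proj: "i < n \<Longrightarrow> rec_in X n (\<lambda>xs. xs ! i)"
  unfolding rec_in_def using recfn.proj by blast

lemma rec_in_comp:
  assumes "rec_in X m g" "\<And>i. i < m \<Longrightarrow> rec_in X n (hs i)"
  shows "rec_in X n (\<lambda>xs. g (map (\<lambda>i. hs i xs) [0..<m]))"
proof -
  obtain g' where g': "recfn X m g'" "\<And>xs. length xs = m \<Longrightarrow> g' xs = g xs"
    using assms(1) unfolding rec_in_def by auto
  have "\<forall>i. \<exists>h. i < m \<longrightarrow> recfn X n h \<and> (\<forall>xs. length xs = n \<longrightarrow> h xs = hs i xs)"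
    using assms(2) unfolding rec_in_def by blast
  then obtain hs' where hs': "\<And>i. i < m \<Longrightarrow> recfn X n (hs' i)"
    "\<And>i xs. i < m \<Longrightarrow> length xs = n \<Longrightarrow> hs' i xs = hs i xs"
    by metis
  have eq: "map (\<lambda>i. hs' i xs) [0..<m] = map (\<lambda>i. hs i xs) [0..<m]" if "length xs = n" for xs
    using hs'(2) that by auto
  show ?thesis
    unfolding rec_in_def
    by (rule exI, rule conjI, rule recfn.comp[OF g'(1) hs'(1)])
      (auto simp: eq g'(2) simp del: map_eq_conv)
qed

lemma rec_in_comp1:
  assumes "rec_in X 1 (\<lambda>xs. g (xs ! 0))" "rec_in X n f"
  shows "rec_in X n (\<lambda>xs. g (f xs))"
  using rec_in_comp[OF assms(1), of n "\<lambda>i. f"] assms(2) by simp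

lemma rec_in_Suc: "rec_in X n f \<Longrightarrow> rec_in X n (\<lambda>xs. Suc (f xs))"
  by (rule rec_in_comp1[where g = Suc]) (use recfn.succ in \<open>auto simp: rec_in_def\<close>)

lemma rec_in_oracle: "rec_in X n f \<Longrightarrow> rec_in X n (\<lambda>xs. if X (f xs) then 1 else 0)"
  by (rule rec_in_comp1[where g = "\<lambda>x. if X x then 1 else 0"]) (use recfn.orac[of X] in \<open>unfold rec_in_def, blast\<close>)

lemma rec_in_const: "rec_in X n (\<lambda>xs. c)"
proof (induction c)
  case 0
  show ?case
    unfolding rec_in_def using recfn.zero by blast
qed (rule rec_in_Suc)

lemma rec_in_prim:
  assumes "rec_in X n g" "rec_in X (Suc (Suc n)) (\<lambda>xs. h (xs ! 0) (xs ! 1) (drop 2 xs))" "rec_in X n b"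
  shows "rec_in X n (\<lambda>xs. rec_nat (g xs) (\<lambda>y r. h y r xs) (b xs))"
proof -
  obtain g' where g': "recfn X n g'" "\<And>xs. length xs = n \<Longrightarrow> g' xs = g xs"
    using assms(1) unfolding rec_in_def by auto
  obtain h' where h': "recfn X (Suc (Suc n)) h'"
    "\<And>y r xs. length xs = n \<Longrightarrow> h' (y # r # xs) = h y r xs"
    using assms(2) unfolding rec_in_def by fastforce
  have "rec_in X (Suc n) (\<lambda>xs. rec_nat (g (tl xs)) (\<lambda>y r. h y r (tl xs)) (hd xs))"
    unfolding rec_in_def
    by (rule exI, rule conjI, rule recfn.prim[OF g'(1) h'(1)]) (simp add: g' h')
  \<comment> \<open>\<open>recfn.prim\<close> recurses on its first argument; composing with the
    argument list \<open>b xs # xs\<close> puts the bound there and keeps \<open>xs\<close> as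
    parameters.\<close>
  then have "rec_in X n (\<lambda>xs. (\<lambda>xs. rec_nat (g (tl xs)) (\<lambda>y r. h y r (tl xs)) (hd xs))
      (map (\<lambda>i. (case i of 0 \<Rightarrow> b | Suc j \<Rightarrow> (\<lambda>xs. xs ! j)) xs) [0..<Suc n]))"
    by (rule rec_in_comp) (auto split: nat.split intro: assms rec_in_proj)
  then show ?thesis
  proof (rule rec_in_cong)
    fix xs :: "nat list"
    assume "length xs = n"
    then have "map (\<lambda>i. (case i of 0 \<Rightarrow> b | Suc j \<Rightarrow> (\<lambda>xs. xs ! j)) xs) [0..<Suc n] = b xs # xs"
      by (intro nth_equalityI) (auto simp del: upt_Suc split: nat.split)
    then show "rec_nat (g (tl (map (\<lambda>i. (case i of 0 \<Rightarrow> b | Suc j \<Rightarrow> (\<lambda>xs. xs ! j)) xs) [0..<Suc n])))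
       (\<lambda>y r. h y r (tl (map (\<lambda>i. (case i of 0 \<Rightarrow> b | Suc j \<Rightarrow> (\<lambda>xs. xs ! j)) xs) [0..<Suc n])))
       (hd (map (\<lambda>i. (case i of 0 \<Rightarrow> b | Suc j \<Rightarrow> (\<lambda>xs. xs ! j)) xs) [0..<Suc n])) =
      rec_nat (g xs) (\<lambda>y r. h y r xs) (b xs)"
      by simp
  qed
qed

lemma rec_in_Least:
  assumes "rec_in X (Suc n) (\<lambda>xs. g (hd xs) (tl xs))" "\<And>xs. length xs = n \<Longrightarrow> \<exists>y. g y xs = 0"
  shows "rec_in X n (\<lambda>xs. LEAST y. g y xs = 0)"
proof -
  obtain g' where g': "recfn X (Suc n) g'" "\<And>y xs. length xs = n \<Longrightarrow> g' (y # xs) = g y xs"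
    using assms(1) unfolding rec_in_def by fastforce
  show ?thesis
    unfolding rec_in_def
    by (rule exI, rule conjI, rule recfn.mu[OF g'(1)]) (simp_all add: g' assms(2))
qed

lemma rec_in_add:
  assumes "rec_in X n f" "rec_in X n g"
  shows "rec_in X n (\<lambda>xs. f xs + g xs)"
proof -
  have "rec_in X n (\<lambda>xs. rec_nat (f xs) (\<lambda>y r. Suc r) (g xs))"
    by (rule rec_in_prim) (auto intro!: assms rec_in_Suc rec_in_proj)
  moreover have "rec_nat a (\<lambda>y r. Suc r) b = a + b" for a b :: nat
    by (induction b) auto
  ultimately show ?thesis
    by simp
qed

lemma rec_in_diff:
  assumes "rec_in X n f" "rec_in X n g"
  shows "rec_in X n (\<lambda>xs. f xs - g xs)"
proof -
  have p: "rec_in X n (\<lambda>xs. u xs - 1)" if "rec_in X n u" for n u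
  proof -
    \<comment> \<open>Predecessor: the recursion discards its previous value and returns the
      counter.\<close>
    have "rec_in X n (\<lambda>xs. rec_nat 0 (\<lambda>y r. y) (u xs))"
      by (rule rec_in_prim) (auto intro!: that rec_in_const rec_in_proj)
    moreover have "rec_nat 0 (\<lambda>y r. y) a = a - 1" for a :: nat
      by (cases a) auto
    ultimately show ?thesis
      by simp
  qed
  have "rec_in X n (\<lambda>xs. rec_nat (f xs) (\<lambda>y r. r - 1) (g xs))"
    by (rule rec_in_prim) (auto simp del: One_nat_def intro!: assms p rec_in_proj)
  moreover have "rec_nat a (\<lambda>y r. r - 1) b = a - b" for a b :: nat
    by (induction b) auto
  ultimately show ?thesis
    by simp
qed

lemma rec_in_triangle:
  assumes "rec_in X n f"
  shows "rec_in X n (\<lambda>xs. triangle (f xs))"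
proof -
  have "rec_in X n (\<lambda>xs. rec_nat 0 (\<lambda>y r. r + Suc y) (f xs))"
    by (rule rec_in_prim) (auto intro!: assms rec_in_const rec_in_add rec_in_Suc rec_in_proj simp del: add_Suc_right)
  moreover have "rec_nat 0 (\<lambda>y r. r + Suc y) a = triangle a" for a :: nat
    by (induction a) auto
  ultimately show ?thesis
    by simp
qed

lemma rec_in_pr:
  assumes "rec_in X n f" "rec_in X n g"
  shows "rec_in X n (\<lambda>xs. pr (f xs) (g xs))"
  unfolding prod_encode_def by (auto intro!: assms rec_in_add rec_in_triangle)

text \<open>The pair coded by \<open>z\<close> lies on the diagonal with index the least \<open>y\<close> such that
  \<open>triangle (Suc y)\<close> exceeds \<open>z\<close>.\<close>

lemma Least_triangle: "(LEAST y. Suc z - triangle (Suc y) = 0) = pfst z + psnd z"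
proof -
  obtain m n where z: "z = pr m n"
    by (metis prod_decode_inverse surj_pair)
  have mono: "triangle a \<le> triangle b" if "a \<le> b" for a b
    using that by (induction rule: dec_induct) auto
  have "(LEAST y. Suc z - triangle (Suc y) = 0) = m + n"
  proof (rule Least_equality)
    show "Suc z - triangle (Suc (m + n)) = 0"
      by (simp add: z prod_encode_def)
  next
    fix y
    assume "Suc z - triangle (Suc y) = 0"
    then have "triangle (m + n) < triangle (Suc y)"
      by (simp add: z prod_encode_def)
    then show "m + n \<le> y"
      using mono[of "Suc y" "m + n"] by force
  qed
  then show ?thesis
    by (simp add: z)
qed

lemma rec_in_pfst_psnd:
  assumes "rec_in X n f"
  shows "rec_in X n (\<lambda>xs. pfst (f xs))" "rec_in X n (\<lambda>xs. psnd (f xs))"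
proof -
  have "rec_in X 1 (\<lambda>xs. LEAST y. Suc (xs ! 0) - triangle (Suc y) = 0)"
  proof (rule rec_in_Least)
    have "rec_in X (Suc 1) (\<lambda>xs. Suc (xs ! 1) - triangle (Suc (xs ! 0)))"
      by (intro rec_in_diff rec_in_triangle rec_in_Suc rec_in_proj) auto
    then show "rec_in X (Suc 1) (\<lambda>xs. Suc (tl xs ! 0) - triangle (Suc (hd xs)))"
      by (rule rec_in_cong) (auto simp: length_Suc_conv)
  next
    fix xs :: "nat list"
    show "\<exists>y. Suc (xs ! 0) - triangle (Suc y) = 0"
      by (rule exI[of _ "xs ! 0"]) simp
  qed
  then have "rec_in X 1 (\<lambda>xs. pfst (xs ! 0) + psnd (xs ! 0))"
    by (simp only: Least_triangle)
  then have s: "rec_in X n (\<lambda>xs. pfst (f xs) + psnd (f xs))"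
    by (rule rec_in_comp1[OF _ assms])
  \<comment> \<open>The code of a pair is the triangular number of its diagonal plus the first
    component.\<close>
  have *: "pfst z = z - triangle (pfst z + psnd z)" for z
  proof -
    have "z = pr (pfst z) (psnd z)"
      by (simp add: pfst_def psnd_def)
    then show ?thesis
      by (simp add: prod_encode_def)
  qed
  have "rec_in X n (\<lambda>xs. f xs - triangle (pfst (f xs) + psnd (f xs)))"
    by (intro rec_in_diff rec_in_triangle assms s)
  then show 1: "rec_in X n (\<lambda>xs. pfst (f xs))"
    by (simp only: *[symmetric])
  have "rec_in X n (\<lambda>xs. (pfst (f xs) + psnd (f xs)) - pfst (f xs))"
    by (intro rec_in_diff s 1)
  then show "rec_in X n (\<lambda>xs. psnd (f xs))"
    by simp
qed

section \<open>Unary computable functions and predicates\<close>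

definition comp_fun :: "(nat \<Rightarrow> bool) \<Rightarrow> (nat \<Rightarrow> nat) \<Rightarrow> bool" where
  "comp_fun X f \<longleftrightarrow> rec_in X 1 (\<lambda>xs. f (xs ! 0))"

definition comp_pred :: "(nat \<Rightarrow> bool) \<Rightarrow> (nat \<Rightarrow> bool) \<Rightarrow> bool" where
  "comp_pred X P \<longleftrightarrow> comp_fun X (\<lambda>x. if P x then 1 else 0)"

lemma comp_fun_comp:
  assumes "comp_fun X g" "comp_fun X f"
  shows "comp_fun X (\<lambda>x. g (f x))"
  using assms rec_in_comp1[of X g 1 "\<lambda>xs. f (xs ! 0)"] unfolding comp_fun_def by simp

lemma comp_fun_id: "comp_fun X (\<lambda>x. x)"
  unfolding comp_fun_def by (rule rec_in_proj) simp

lemma comp_fun_const: "comp_fun X (\<lambda>x. c)"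
  unfolding comp_fun_def by (rule rec_in_const)

lemma comp_fun_basic:
  assumes "comp_fun X f"
  shows "comp_fun X (\<lambda>x. Suc (f x))" "comp_fun X (\<lambda>x. pfst (f x))" "comp_fun X (\<lambda>x. psnd (f x))"
    "comp_pred X (\<lambda>x. X (f x))"
  using assms rec_in_Suc rec_in_pfst_psnd rec_in_oracle unfolding comp_pred_def comp_fun_def by simp_all

lemma comp_fun_binary:
  assumes "comp_fun X f" "comp_fun X g"
  shows "comp_fun X (\<lambda>x. f x + g x)" "comp_fun X (\<lambda>x. f x - g x)" "comp_fun X (\<lambda>x. pr (f x) (g x))"
  using assms rec_in_add rec_in_diff rec_in_pr unfolding comp_fun_def by simp_all

text \<open>Step functions take their arguments packed into a single number.\<close>

lemma comp_fun_rec: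
  assumes "comp_fun X g" "comp_fun X (\<lambda>z. h (pfst z) (pfst (psnd z)) (psnd (psnd z)))" "comp_fun X b"
  shows "comp_fun X (\<lambda>x. rec_nat (g x) (\<lambda>y r. h y r x) (b x))"
  unfolding comp_fun_def
proof (rule rec_in_prim)
  have "rec_in X 3 (\<lambda>xs. pr (xs ! 0) (pr (xs ! 1) (xs ! 2)))"
    by (intro rec_in_pr rec_in_proj) auto
  then have "rec_in X 3 (\<lambda>xs. h (xs ! 0) (xs ! 1) (xs ! 2))"
    using rec_in_comp1[OF assms(2)[unfolded comp_fun_def]] by fastforce
  then show "rec_in X (Suc (Suc 1)) (\<lambda>xs. h (xs ! 0) (xs ! 1) (drop 2 xs ! 0))"
    unfolding numeral_3_eq_3 One_nat_def by (rule rec_in_cong) simp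
qed (use assms in \<open>simp_all add: comp_fun_def\<close>)

lemma comp_fun_Least:
  assumes "comp_fun X (\<lambda>z. g (pfst z) (psnd z))" "\<And>x. \<exists>y. g y x = 0"
  shows "comp_fun X (\<lambda>x. LEAST y. g y x = 0)"
  unfolding comp_fun_def
proof (rule rec_in_Least)
  have "rec_in X 2 (\<lambda>xs. pr (xs ! 0) (xs ! 1))"
    by (intro rec_in_pr rec_in_proj) auto
  then have "rec_in X 2 (\<lambda>xs. g (xs ! 0) (xs ! 1))"
    using rec_in_comp1[OF assms(1)[unfolded comp_fun_def]] by fastforce
  then show "rec_in X (Suc 1) (\<lambda>xs. g (hd xs) (tl xs ! 0))"
    unfolding numeral_2_eq_2 One_nat_def by (rule rec_in_cong) (auto simp: length_Suc_conv)
qed (rule assms)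

text \<open>A case distinction is a recursion of length 0 or 1: the base value is the else branch,
  and a single step replaces it by the then branch.\<close>

lemma comp_fun_if:
  assumes "comp_pred X P" "comp_fun X f" "comp_fun X g"
  shows "comp_fun X (\<lambda>x. if P x then f x else g x)"
proof -
  have "comp_fun X (\<lambda>x. rec_nat (g x) (\<lambda>y r. f x) (if P x then 1 else 0))"
    by (intro comp_fun_rec comp_fun_comp[OF assms(2)] comp_fun_basic comp_fun_id assms
        assms(1)[unfolded comp_pred_def])
  moreover have "rec_nat (g x) (\<lambda>y r. f x) (if P x then 1 else 0) = (if P x then f x else g x)" for x
    by simp
  ultimately show ?thesis
    by (simp only:)
qed

lemma comp_pred_logic:
  assumes "comp_pred X P"
  shows "comp_pred X (\<lambda>x. \<not> P x)"
    and "comp_pred X Q \<Longrightarrow> comp_pred X (\<lambda>x. P x \<and> Q x)"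
    and "comp_pred X Q \<Longrightarrow> comp_pred X (\<lambda>x. P x \<or> Q x)"
    and "comp_pred X Q \<Longrightarrow> comp_pred X (\<lambda>x. P x \<longrightarrow> Q x)"
proof -
  have *: "(\<lambda>x. if \<not> P x then 1 else 0) = (\<lambda>x. if P x then 0 else 1 :: nat)"
    "(\<lambda>x. if P x \<and> Q x then 1 else 0) = (\<lambda>x. if P x then if Q x then 1 else 0 else 0 :: nat)"
    "(\<lambda>x. if P x \<or> Q x then 1 else 0) = (\<lambda>x. if P x then 1 else if Q x then 1 else 0 :: nat)"
    "(\<lambda>x. if P x \<longrightarrow> Q x then 1 else 0) = (\<lambda>x. if P x then if Q x then 1 else 0 else 1 :: nat)"
    by auto
  show "comp_pred X (\<lambda>x. \<not> P x)"
    unfolding comp_pred_def * by (intro comp_fun_if assms comp_fun_const)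
  show "comp_pred X (\<lambda>x. P x \<and> Q x)" "comp_pred X (\<lambda>x. P x \<or> Q x)" "comp_pred X (\<lambda>x. P x \<longrightarrow> Q x)"
    if "comp_pred X Q"
    unfolding comp_pred_def * by (intro comp_fun_if assms that comp_fun_const)+
qed

lemma comp_pred_order:
  assumes "comp_fun X f" "comp_fun X g"
  shows "comp_pred X (\<lambda>x. f x < g x)" "comp_pred X (\<lambda>x. f x = g x)"
proof -
  have lt: "comp_pred X (\<lambda>x. u x < v x)" if "comp_fun X u" "comp_fun X v" for u v
  proof -
    have "comp_fun X (\<lambda>x. 1 - (1 - (v x - u x)))"
      by (intro comp_fun_binary comp_fun_const that)
    moreover have "1 - (1 - (v x - u x)) = (if u x < v x then 1 else 0)" for x
      by auto
    ultimately show ?thesis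
      unfolding comp_pred_def by (simp only:)
  qed
  show "comp_pred X (\<lambda>x. f x < g x)"
    by (rule lt[OF assms])
  have "comp_pred X (\<lambda>x. \<not> f x < g x \<and> \<not> g x < f x)"
    by (intro comp_pred_logic lt assms)
  moreover have "(\<not> f x < g x \<and> \<not> g x < f x) = (f x = g x)" for x
    by auto
  ultimately show "comp_pred X (\<lambda>x. f x = g x)"
    by simp
qed

lemma comp_pred_bounded:
  assumes "comp_fun X b" "comp_pred X (\<lambda>z. P (pfst z) (psnd z))"
  shows "comp_pred X (\<lambda>x. \<forall>y<b x. P y x)" "comp_pred X (\<lambda>x. \<exists>y<b x. P y x)"
proof -
  have all: "comp_pred X (\<lambda>x. \<forall>y<b x. Q y x)" if "comp_pred X (\<lambda>z. Q (pfst z) (psnd z))" for Q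
  proof -
    \<comment> \<open>Here \<open>z\<close> packs the counter, the previous value and the parameter
      in this order; \<open>Q\<close> takes the first and the third.\<close>
    have "comp_fun X (\<lambda>z. if Q (pfst z) (psnd (psnd z)) then pfst (psnd z) else 0)"
    proof (rule comp_fun_if)
      have "comp_fun X (\<lambda>z. pr (pfst z) (psnd (psnd z)))"
        by (intro comp_fun_basic comp_fun_binary comp_fun_id)
      from comp_fun_comp[OF that[unfolded comp_pred_def] this]
      show "comp_pred X (\<lambda>z. Q (pfst z) (psnd (psnd z)))"
        by (simp add: comp_pred_def)
    qed (intro comp_fun_basic comp_fun_id comp_fun_const)+
    then have "comp_fun X (\<lambda>x. rec_nat 1 (\<lambda>y r. if Q y x then r else 0) (b x))"
      by (intro comp_fun_rec comp_fun_const assms(1))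
    moreover have "rec_nat 1 (\<lambda>y r. if Q y x then r else 0) n = (if \<forall>y<n. Q y x then 1 else 0 :: nat)" for x n
      by (induction n) (auto simp: less_Suc_eq)
    ultimately show ?thesis
      unfolding comp_pred_def by (simp only:)
  qed
  show "comp_pred X (\<lambda>x. \<forall>y<b x. P y x)"
    by (rule all[OF assms(2)])
  have "comp_pred X (\<lambda>x. \<not> (\<forall>y<b x. \<not> P y x))"
    by (intro all comp_pred_logic(1) assms)
  then show "comp_pred X (\<lambda>x. \<exists>y<b x. P y x)"
    by simp
qed

section \<open>Computing with list codes\<close>

definition nth_code :: "nat \<Rightarrow> nat \<Rightarrow> nat" where
  "nth_code c i = pfst (rec_nat c (\<lambda>_ r. psnd (r - 1)) i - 1)"

definition len_code :: "nat \<Rightarrow> nat" where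
  "len_code c = (LEAST n. rec_nat c (\<lambda>_ r. psnd (r - 1)) n = 0)"

text \<open>The code of a nonempty list is the successor of a pair, so \<open>psnd (r - 1)\<close>
  passes to the tail. The code 0 of \<open>[]\<close> is a fixed point, which covers iteration past
  the end.\<close>

lemma drop_code: "rec_nat (list_encode xs) (\<lambda>_ r. psnd (r - 1)) n = list_encode (drop n xs)"
proof (induction n)
  case (Suc n)
  have "psnd 0 = 0"
    using psnd_pr[of 0 0] by (simp add: prod_encode_def)
  then have "psnd (list_encode ys - 1) = list_encode (tl ys)" for ys
    by (cases ys) auto
  with Suc show ?case
    by (simp add: drop_Suc tl_drop)
qed simp

lemma list_encode_eq_0: "list_encode xs = 0 \<longleftrightarrow> xs = []"
  by (cases xs) auto

lemma nth_code: "i < length xs \<Longrightarrow> nth_code (list_encode xs) i = xs ! i"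
  unfolding nth_code_def drop_code by (subst Cons_nth_drop_Suc[symmetric]) auto

lemma len_code: "len_code (list_encode xs) = length xs"
  unfolding len_code_def drop_code list_encode_eq_0 by (intro Least_equality) auto

lemma comp_fun_nth_code:
  assumes "comp_fun X f" "comp_fun X g"
  shows "comp_fun X (\<lambda>x. nth_code (f x) (g x))"
  unfolding nth_code_def
  by (intro comp_fun_rec comp_fun_basic comp_fun_binary comp_fun_const comp_fun_id assms)

lemma comp_fun_len_code:
  assumes "comp_fun X f"
  shows "comp_fun X (\<lambda>x. len_code (f x))"
  unfolding len_code_def
proof (rule comp_fun_comp[OF comp_fun_Least assms])
  show "comp_fun X (\<lambda>z. rec_nat (psnd z) (\<lambda>_ r. psnd (r - 1)) (pfst z))"
    by (intro comp_fun_rec comp_fun_basic comp_fun_binary comp_fun_const comp_fun_id)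
next
  fix c
  show "\<exists>n. rec_nat c (\<lambda>_ r. psnd (r - 1)) n = 0"
    using drop_code[of "list_decode c" "length (list_decode c)"] by auto
qed

lemmas comp_intros =
  comp_fun_id comp_fun_const comp_fun_basic comp_fun_binary comp_fun_if comp_fun_nth_code
  comp_fun_len_code comp_pred_logic comp_pred_order comp_pred_bounded

lemma computable_inI:
  assumes "comp_pred X (\<lambda>z. (pfst z, psnd z) \<in> W)"
  shows "computable_in X W"
proof -
  have "rec_in X 2 (\<lambda>xs. pr (xs ! 0) (xs ! 1))"
    by (intro rec_in_pr rec_in_proj) auto
  then have "rec_in X 2 (\<lambda>xs. if (xs ! 0, xs ! 1) \<in> W then 1 else 0)"
    using rec_in_comp1[OF assms[unfolded comp_pred_def comp_fun_def]] by fastforce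
  then obtain f where "recfn X 2 f"
    "\<And>xs. length xs = 2 \<Longrightarrow> f xs = (if (xs ! 0, xs ! 1) \<in> W then 1 else 0)"
    unfolding rec_in_def by auto
  then show ?thesis
    unfolding computable_in_def by (intro exI[of _ f]) simp
qed

section \<open>Back-and-forth relations\<close>

lemma back_forth_mono: "R \<subseteq> S \<Longrightarrow> back_forth R \<subseteq> back_forth S"
  unfolding back_forth_def by blast

context
  fixes W :: "'i rel"
  assumes W: "Well_order W"
begin

abbreviation below :: "'i \<Rightarrow> 'i \<Rightarrow> bool" where "below j i \<equiv> (j, i) \<in> W \<and> j \<noteq> i"

lemma below_wf: "wf (W - Id)"
  using W unfolding well_order_on_def by blast

lemma below_linear: "i \<in> Field W \<Longrightarrow> j \<in> Field W \<Longrightarrow> i = j \<or> below i j \<or> below j i"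
  using W unfolding well_order_on_def linear_order_on_def total_on_def by metis

lemma below_induct [case_names less]:
  assumes "\<And>i. (\<And>j. below j i \<Longrightarrow> P j) \<Longrightarrow> P i"
  shows "P i"
  using below_wf by (induction i rule: wf_induct_rule) (use assms in blast)

lemma immediate_pred_unique:
  assumes "immediate_pred W j i" "immediate_pred W k i"
  shows "j = k"
proof -
  have "j \<in> Field W" "k \<in> Field W"
    using assms unfolding immediate_pred_def Field_def by blast+
  then show ?thesis
    using below_linear[of j k] assms unfolding immediate_pred_def by blast
qed

text \<open>\<open>bf_step\<close> at \<open>i\<close> consults its recursive argument only strictly
  below \<open>i\<close>, where \<open>cut\<close> changes nothing.\<close>

lemma bf_rel_unfold: "bf_rel W i = bf_step W (bf_rel W) i"
proof -
  have cut: "cut (bf_rel W) (W - Id) i j = bf_rel W j" if "below j i" for j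
    using that by (auto simp: cut_def)
  have "bf_rel W i = bf_step W (cut (bf_rel W) (W - Id) i) i"
    unfolding bf_rel_def by (rule wfrec[OF below_wf])
  also have "\<dots> = bf_step W (bf_rel W) i"
    unfolding bf_step_def
  proof (intro if_cong refl, goal_cases)
    case 1
    then obtain j where j: "immediate_pred W j i" by blast
    then have "(THE j. immediate_pred W j i) = j"
      using immediate_pred_unique by blast
    moreover have "below j i"
      using j unfolding immediate_pred_def by blast
    ultimately show ?case
      by (simp add: cut)
  next
    case 2
    show ?case by (auto simp: cut)
  qed
  finally show ?thesis .
qed

lemma bf_rel_bottom:
  "\<not> (\<exists>j. below j i) \<Longrightarrow> bf_rel W i = {(as, bs). partial_U_iso as bs}"
  by (subst bf_rel_unfold) (auto simp: bf_step_def)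

lemma bf_rel_succ: "immediate_pred W j i \<Longrightarrow> bf_rel W i = back_forth (bf_rel W j)"
proof -
  assume j: "immediate_pred W j i"
  then have "(THE j. immediate_pred W j i) = j"
    using immediate_pred_unique by blast
  then show ?thesis
    using j by (subst bf_rel_unfold) (auto simp: bf_step_def immediate_pred_def)
qed

lemma bf_rel_limit:
  "below k i \<Longrightarrow> \<not> (\<exists>j. immediate_pred W j i) \<Longrightarrow>
    bf_rel W i = {(as, bs). length as = length bs \<and> (\<forall>j. below j i \<longrightarrow> (as, bs) \<in> bf_rel W j)}"
  by (subst bf_rel_unfold) (auto simp: bf_step_def)

lemma bf_rel_cases [case_names bottom succ limit]:
  fixes i :: 'i and R :: "'i \<Rightarrow> ('a::metric_space list \<times> 'a list) set"
  defines "R \<equiv> bf_rel W"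
  obtains "\<not> (\<exists>j. below j i)" "R i = {(as, bs). partial_U_iso as bs}"
  | j where "immediate_pred W j i" "R i = back_forth (R j)"
  | k where "below k i" "\<not> (\<exists>j. immediate_pred W j i)"
    "R i = {(as, bs). length as = length bs \<and> (\<forall>j. below j i \<longrightarrow> (as, bs) \<in> R j)}"
proof (cases "\<exists>j. below j i")
  case True
  then obtain k where "below k i" by blast
  then show ?thesis
    using that(2)[unfolded R_def, OF _ bf_rel_succ] that(3)[unfolded R_def, OF _ _ bf_rel_limit] by (cases "\<exists>j. immediate_pred W j i") auto
next
  case False
  then show ?thesis
    using that(1)[unfolded R_def, OF _ bf_rel_bottom] by auto
qed

lemma below_succ: "immediate_pred W p i \<Longrightarrow> below j i \<Longrightarrow> j = p \<or> below j p"
  using below_linear[of j p] unfolding immediate_pred_def Field_def by blast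

lemma partial_U_iso_butlast:
  assumes "partial_U_iso (as @ [a]) (bs @ [b])"
  shows "partial_U_iso as bs"
proof -
  have len: "length as = length bs"
    using assms unfolding partial_U_iso_def by simp
  show ?thesis
    unfolding partial_U_iso_def
  proof (rule conjI[OF len], rule allI, rule impI, rule allI, rule impI, goal_cases)
    case (1 i j)
    with assms[unfolded partial_U_iso_def, THEN conjunct2, THEN spec[of _ i], THEN mp,
        THEN spec[of _ j], THEN mp] len
    show ?case by (simp add: nth_append)
  qed
qed

text \<open>The inclusions need each other: at a successor the first one is the second one for the
  predecessor, and at a limit the second follows from the first by monotonicity of
  \<open>back_forth\<close>.\<close>

lemma bf_rel_decreasing:
  fixes i :: 'i
  shows "(\<forall>j. below j i \<longrightarrow> bf_rel W i \<subseteq> (bf_rel W j :: ('a::metric_space list \<times> 'a list) set)) \<and>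
    back_forth (bf_rel W i) \<subseteq> (bf_rel W i :: ('a list \<times> 'a list) set)"
proof (induction i rule: below_induct)
  case (less i)
  let ?R = "bf_rel W :: 'i \<Rightarrow> ('a list \<times> 'a list) set"
  show ?case
  proof (cases rule: bf_rel_cases[of i, where ?'a = 'a])
    case bottom
    have "back_forth (?R i) \<subseteq> ?R i"
      unfolding bottom(2) back_forth_def by (auto dest: partial_U_iso_butlast)
    with bottom show ?thesis by blast
  next
    case (succ p)
    have p: "below p i"
      using succ(1) unfolding immediate_pred_def by blast
    have "?R i \<subseteq> ?R p"
      using less[OF p] succ(2) by blast
    then show ?thesis
      using less[OF p] succ(2) below_succ[OF succ(1)] back_forth_mono by blast
  next
    case (limit k)
    have sub: "?R i \<subseteq> ?R j" if "below j i" for j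
      using that unfolding limit(3) by blast
    have "back_forth (?R i) \<subseteq> ?R j" if "below j i" for j
      using less[OF that] back_forth_mono[OF sub[OF that]] by blast
    \<comment> \<open>The limit clause asks for equal lengths explicitly; they are read off the
      lists extended by one point.\<close>
    moreover have "length as = length bs" if "(as, bs) \<in> back_forth (?R i)" for as bs
      using that unfolding limit(3) back_forth_def by auto
    ultimately have "back_forth (?R i) \<subseteq> ?R i"
      by (subst (2) limit(3)) blast
    with sub show ?thesis by blast
  qed
qed

lemma bf_rel_antimono: "below j i \<Longrightarrow> bf_rel W i \<subseteq> bf_rel W j"
  using bf_rel_decreasing by blast

text \<open>This allows a step from a node to any smaller one, whether or not it is the immediate
  predecessor. At a limit some \<open>l\<close> lies strictly between \<open>j\<close> and
  \<open>i\<close>, and the induction hypothesis for \<open>l\<close> applies.\<close>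

lemma bf_rel_back_forth:
  "below j i \<Longrightarrow> bf_rel W i \<subseteq> (back_forth (bf_rel W j) :: ('a::metric_space list \<times> 'a list) set)"
proof (induction i rule: below_induct)
  case (less i)
  show ?case
  proof (cases rule: bf_rel_cases[of i, where ?'a = 'a])
    case bottom
    with less show ?thesis by blast
  next
    case (succ p)
    then have "(bf_rel W p :: ('a list \<times> 'a list) set) \<subseteq> bf_rel W j"
      using below_succ[OF succ(1) less.prems] bf_rel_antimono by blast
    then show ?thesis
      unfolding succ(2) by (rule back_forth_mono)
  next
    case (limit k)
    then obtain l where "below j l" "below l i"
      using less.prems unfolding immediate_pred_def by blast
    then show ?thesis
      using less.IH bf_rel_antimono by blast
  qed
qed

lemma bf_rel_partial_U_iso: "(as, bs) \<in> bf_rel W i \<Longrightarrow> partial_U_iso as bs"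
proof (induction i rule: below_induct)
  case (less i)
  show ?case
  proof (cases "\<exists>j. below j i")
    case True
    then show ?thesis
      using less bf_rel_antimono by blast
  next
    case False
    then show ?thesis
      using less.prems bf_rel_bottom by blast
  qed
qed

text \<open>Its purpose is to show that a pair with \<open>SR_pair_finite\<close> consists of
  distinct tuples.\<close>

lemma bf_rel_refl: "(as, as) \<in> bf_rel W i"
proof (induction i arbitrary: as rule: below_induct)
  case (less i)
  show ?case
  proof (cases rule: bf_rel_cases[of i, where ?'a = 'a])
    case bottom
    then show ?thesis by (simp add: partial_U_iso_def)
  next
    case (succ p)
    then have "below p i"
      unfolding immediate_pred_def by blast
    then have "(bs, bs) \<in> bf_rel W p" for bs :: "'a list"
      by (rule less)
    with succ(2) show ?thesis
      unfolding back_forth_def by blast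
  next
    case (limit k)
    with less show ?thesis by auto
  qed
qed

end

section \<open>The Kleene--Brouwer order\<close>

text \<open>The Kleene--Brouwer order on lists: proper extensions come first.\<close>

definition kb_less :: "(nat list \<times> nat list) set" where
  "kb_less = {(s, t). (t, s) \<in> lexord {(x, y). y < x}}"

text \<open>Only positions are quantified here, with bounds, so this form can be carried over to a
  computable predicate on codes.\<close>

lemma kb_less_iff:
  "(s, t) \<in> kb_less \<longleftrightarrow> (length t < length s \<and> (\<forall>i<length t. s ! i = t ! i)) \<or>
     (\<exists>i<length t. i < length s \<and> (\<forall>j<i. s ! j = t ! j) \<and> s ! i < t ! i)"
proof -
  have take: "take n s = take n t \<longleftrightarrow> (\<forall>j<n. s ! j = t ! j)" if "n \<le> length s" "n \<le> length t" for n
    using that by (auto simp: list_eq_iff_nth_eq)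
  have "take (length t) s = t \<longleftrightarrow> (\<forall>j<length t. s ! j = t ! j)" if "length t < length s"
    using take[of "length t"] that by simp
  moreover have "take i t = take i s \<longleftrightarrow> (\<forall>j<i. s ! j = t ! j)" if "i < length t" "i < length s" for i
    using take[of i] that by (metis less_imp_le)
  ultimately show ?thesis
    unfolding kb_less_def lexord_take_index_conv by auto
qed

lemma kb_less_trans: "(s, t) \<in> kb_less \<Longrightarrow> (t, u) \<in> kb_less \<Longrightarrow> (s, u) \<in> kb_less"
  unfolding kb_less_def using lexord_trans[of u t "{(x, y). y < x}" s] by (auto simp: trans_def)

lemma kb_less_irrefl: "(s, s) \<notin> kb_less"
  unfolding kb_less_def using lexord_irreflexive[of "{(x, y). (y :: nat) < x}" s] by simp

lemma kb_less_linear: "s = t \<or> (s, t) \<in> kb_less \<or> (t, s) \<in> kb_less"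
  unfolding kb_less_def using lexord_linear[of "{(x, y). (y :: nat) < x}" s t] linorder_less_linear
  by (metis (mono_tags, lifting) case_prodI mem_Collect_eq)

lemma kb_less_append: "xs \<noteq> [] \<Longrightarrow> (s @ xs, s) \<in> kb_less"
  unfolding kb_less_iff by (simp add: nth_append)

lemma kb_less_siblings: "x < y \<Longrightarrow> (s @ x # xs, s @ y # ys) \<in> kb_less"
  unfolding kb_less_iff by (intro disjI2 exI[of _ "length s"]) (auto simp: nth_append)

text \<open>A descending chain gains one entry per step, so \<open>F (Suc i)\<close> has a position
  \<open>i\<close>; reading the chain along the diagonal gives an infinite branch of
  \<open>T\<close>.\<close>

lemma wf_children:
  assumes closed: "\<forall>s x. s @ [x] \<in> T \<longrightarrow> s \<in> T"
    and no_branch: "\<forall>f. \<exists>n. map f [0..<n] \<notin> T"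
  shows "wf {(s @ [x], s) | s x. s @ [x] \<in> T}"
  unfolding wf_iff_no_infinite_down_chain
proof
  assume "\<exists>F. \<forall>n. (F (Suc n), F n) \<in> {(s @ [x], s) | s x. s @ [x] \<in> T}"
  then obtain F where "\<And>n. (F (Suc n), F n) \<in> {(s @ [x], s) | s x. s @ [x] \<in> T}"
    by blast
  then have F: "\<exists>x. F (Suc n) = F n @ [x] \<and> F (Suc n) \<in> T" for n
    by fastforce
  have "length (F (Suc n)) = Suc (length (F n))" for n
    using F[of n] by auto
  then have len: "length (F n) = length (F 0) + n" for n
    by (induction n) auto
  have nth: "i < length (F m) \<Longrightarrow> m \<le> n \<Longrightarrow> F n ! i = F m ! i" for i m n
  proof (induction n rule: nat_induct)
    case (Suc n)
    then show ?case
      using F[of n] len[of n] len[of m] by (cases "m \<le> n") (auto simp: nth_append le_Suc_eq)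
  qed simp
  have take: "take n s \<in> T" if "s \<in> T" for n s
    using that
  proof (induction "length s - n" arbitrary: s)
    case (Suc k)
    then have "s \<noteq> []" by auto
    then obtain u x where u: "s = u @ [x]"
      by (metis append_butlast_last_id)
    then have "take n u \<in> T"
      using Suc closed by auto
    moreover have "take n u = take n s"
      using u Suc by auto
    ultimately show ?case by simp
  qed simp
  obtain n where n: "map (\<lambda>i. F (Suc i) ! i) [0..<n] \<notin> T"
    using no_branch by blast
  have "map (\<lambda>i. F (Suc i) ! i) [0..<n] = take n (F (Suc n))"
  proof (rule nth_equalityI)
    show "length (map (\<lambda>i. F (Suc i) ! i) [0..<n]) = length (take n (F (Suc n)))"
      by (simp add: len[of "Suc n"])
    fix i
    assume "i < length (map (\<lambda>i. F (Suc i) ! i) [0..<n])"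
    then have "i < n" by simp
    moreover have "i < length (F (Suc i))"
      unfolding len[of "Suc i"] by simp
    ultimately have "F (Suc n) ! i = F (Suc i) ! i"
      by (intro nth) auto
    with \<open>i < n\<close> show "map (\<lambda>i. F (Suc i) ! i) [0..<n] ! i = take n (F (Suc n)) ! i"
      by simp
  qed
  moreover have "F (Suc n) \<in> T"
    using F[of n] by blast
  ultimately show False
    using n take by simp
qed

text \<open>Induction along the child relation: among extensions of \<open>s\<close>, take the least
  child through which the set passes. A minimal element below that child precedes \<open>s\<close>
  itself and everything that passes through larger siblings.\<close>

lemma wf_kb:
  assumes closed: "\<forall>s x. s @ [x] \<in> T \<longrightarrow> s \<in> T"
    and no_branch: "\<forall>f. \<exists>n. map f [0..<n] \<notin> T"
  shows "wf (Restr kb_less T)"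
proof -
  define minimal where "minimal Q s \<longleftrightarrow> s \<in> Q \<and> (\<forall>t\<in>Q. (t, s) \<notin> kb_less)" for Q s
  have subtree: "\<exists>u. minimal Q u"
    if "Q \<noteq> {}" "\<And>t. t \<in> Q \<Longrightarrow> t \<in> T \<and> (\<exists>xs. t = s @ xs)" for Q s
    using that
  proof (induction s arbitrary: Q rule: wf_induct_rule[OF wf_children[OF assms], case_names less])
    case (less s)
    show ?case
    proof (cases "\<exists>x xs. s @ x # xs \<in> Q")
      case True
      define x where "x = (LEAST x. \<exists>xs. s @ x # xs \<in> Q)"
      define Q' where "Q' = {t \<in> Q. \<exists>xs. t = s @ x # xs}"
      have "\<exists>xs. s @ x # xs \<in> Q"
        unfolding x_def using True by (rule LeastI_ex)
      then obtain xs where xs: "s @ x # xs \<in> Q" by blast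
      have "(s @ [x]) @ xs \<in> T"
        using less.prems(2) xs by simp
      then have "s @ [x] \<in> T"
        by (induction xs rule: rev_induct) (use closed in \<open>auto simp flip: append_assoc\<close>)
      then have "\<exists>u. minimal Q' u"
        using less.IH[of "s @ [x]" Q'] xs less.prems(2) unfolding Q'_def by fastforce
      then obtain u where u: "minimal Q' u" by blast
      then obtain us where us: "u = s @ x # us"
        unfolding minimal_def Q'_def by blast
      have "(t, u) \<notin> kb_less" if t: "t \<in> Q" for t
      proof (cases "t \<in> Q'")
        case True
        with u show ?thesis unfolding minimal_def by blast
      next
        case False
        have "(u, t) \<in> kb_less"
        proof (cases "t = s")
          case True
          then show ?thesis using us kb_less_append by simp
        next
          case False
          then obtain y ys where y: "t = s @ y # ys"
            using less.prems(2)[OF t] by (metis append_Nil2 neq_Nil_conv)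
          then have "x \<le> y"
            unfolding x_def using t by (intro Least_le) blast
          with \<open>t \<notin> Q'\<close> y t have "x < y"
            unfolding Q'_def by (cases "x = y") auto
          then show ?thesis using us y kb_less_siblings by simp
        qed
        then show ?thesis using kb_less_trans kb_less_irrefl by blast
      qed
      with u have "minimal Q u"
        unfolding minimal_def Q'_def by blast
      then show ?thesis ..
    next
      case False
      then have "Q = {s}"
        using less.prems by (metis append_Nil2 neq_Nil_conv is_singletonI' is_singleton_def empty_iff insertI1 subset_singletonD subsetI all_not_in_conv)
      then show ?thesis
        unfolding minimal_def using kb_less_irrefl by blast
    qed
  qed
  show ?thesis
  proof (rule wfI_min)
    fix u and Q :: "nat list set"
    assume u: "u \<in> Q"
    show "\<exists>z\<in>Q. \<forall>y. (y, z) \<in> Restr kb_less T \<longrightarrow> y \<notin> Q"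
    proof (cases "Q \<inter> T = {}")
      case False
      then obtain z where "minimal (Q \<inter> T) z"
        using subtree[of "Q \<inter> T" "[]"] by auto
      then show ?thesis
        unfolding minimal_def by blast
    qed (use u in blast)
  qed
qed

definition kb_order :: "nat list set \<Rightarrow> nat rel" where
  "kb_order T = {(x, y). list_decode x \<in> T \<and> list_decode y \<in> T \<and>
     (x = y \<or> (list_decode x, list_decode y) \<in> kb_less)}"

lemma Field_kb_order: "Field (kb_order T) = {x. list_decode x \<in> T}"
  unfolding Field_def kb_order_def by auto

lemma Well_order_kb_order:
  assumes closed: "\<forall>s x. s @ [x] \<in> T \<longrightarrow> s \<in> T"
    and no_branch: "\<forall>f. \<exists>n. map f [0..<n] \<notin> T"
  shows "Well_order (kb_order T)"
proof -
  have "refl_on (Field (kb_order T)) (kb_order T)" "kb_order T \<subseteq> Field (kb_order T) \<times> Field (kb_order T)"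
    unfolding refl_on_def Field_kb_order unfolding kb_order_def by auto
  moreover have "trans (kb_order T)"
    unfolding kb_order_def by (rule transI) (auto dest: kb_less_trans)
  moreover have "antisym (kb_order T)"
    unfolding kb_order_def by (rule antisymI) (auto dest: kb_less_trans simp: kb_less_irrefl)
  moreover have "total_on (Field (kb_order T)) (kb_order T)"
    unfolding total_on_def Field_kb_order unfolding kb_order_def
    using kb_less_linear by simp (metis list_decode_eq)
  moreover have "kb_order T - Id \<subseteq> inv_image (Restr kb_less T) list_decode"
    unfolding kb_order_def by auto
  then have "wf (kb_order T - Id)"
    by (rule wf_subset[OF wf_inv_image[OF wf_kb[OF assms]]])
  ultimately show ?thesis
    unfolding well_order_on_def linear_order_on_def partial_order_on_def preorder_on_def by blast
qed

section \<open>The tree of approximate automorphisms\<close>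

text \<open>The code of \<open>d m n < (p + 1) / (r + 1)\<close> (for \<open>t = 0\<close>) or of \<open>>\<close> (for \<open>t = 1\<close>) in \<^const>\<open>metric_code\<close>.\<close>

definition query :: "nat \<Rightarrow> nat \<Rightarrow> nat \<Rightarrow> nat \<Rightarrow> nat \<Rightarrow> nat" where
  "query t p r m n = pr t (pr p (pr r (pr m n)))"

lemma metric_code_query:
  "metric_code d (query 0 p r m n) \<longleftrightarrow> d m n < real (Suc p) / real (Suc r)"
  "metric_code d (query 1 p r m n) \<longleftrightarrow> real (Suc p) / real (Suc r) < d m n"
  unfolding metric_code_def query_def by auto

text \<open>A node is a list \<open>[_, c, w\<^sub>0, w\<^sub>1, \<dots>]\<close>. The automorphism is described by pairs (point, image)
  with index \<open>l\<close>: if \<open>pfst l = 0\<close> then the point is the dense point with number \<open>psnd l\<close> and its image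
  is unknown, otherwise the image is that dense point and the preimage is unknown. The entry \<open>w\<^sub>k\<close>
  codes a list whose members with index \<open>l < k\<close> approximate the unknown points. The entry \<open>c\<close> codes
  the index of a pair and an \<open>r\<close> such that the two points of the pair have distance more than
  \<open>1 / (r + 1)\<close>. The first entry is irrelevant; it provides a node \<open>[0]\<close> strictly below the
  top node \<open>[]\<close>.\<close>

definition approx :: "(nat \<Rightarrow> nat) \<Rightarrow> nat \<Rightarrow> nat \<Rightarrow> nat" where
  "approx f k l = nth_code (f (k + 2)) l"

definition left_pt :: "(nat \<Rightarrow> nat) \<Rightarrow> nat \<Rightarrow> nat \<Rightarrow> nat" where
  "left_pt f k l = (if pfst l = 0 then psnd l else approx f k l)"

definition right_pt :: "(nat \<Rightarrow> nat) \<Rightarrow> nat \<Rightarrow> nat \<Rightarrow> nat" where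
  "right_pt f k l = (if pfst l = 0 then approx f k l else psnd l)"

text \<open>The second condition is a decidable version of ``the distances on both sides are
  approximately equal''; the rationals that it tests become dense as \<open>k\<close> grows.\<close>

definition stage :: "(nat \<Rightarrow> bool) \<Rightarrow> (nat \<Rightarrow> nat) \<Rightarrow> nat \<Rightarrow> bool" where
  "stage X f k \<longleftrightarrow>
     (\<forall>j<k. \<forall>l<j. X (query 0 0 j (approx f j l) (approx f k l))) \<and>
     (\<forall>l<k. \<forall>l'<k. \<forall>p<k. \<forall>r<k.
        \<not> (X (query 0 p r (left_pt f k l) (left_pt f k l')) \<and>
           X (query 1 (Suc p) r (right_pt f k l) (right_pt f k l'))) \<and>
        \<not> (X (query 0 p r (right_pt f k l) (right_pt f k l')) \<and>
           X (query 1 (Suc p) r (left_pt f k l) (left_pt f k l')))) \<and>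
     (pfst (f 1) < k \<and> psnd (f 1) < k \<longrightarrow>
        X (query 1 0 (psnd (f 1)) (left_pt f k (pfst (f 1))) (right_pt f k (pfst (f 1)))))"

text \<open>The last entry that stage \<open>k\<close> reads is \<open>w_k\<close>, at position
  \<open>k + 2\<close>. So a stage can be judged on a finite node and has the same verdict on every
  extension.\<close>

lemma stage_cong:
  assumes "\<And>i. i < k + 3 \<Longrightarrow> f i = g i"
  shows "stage X f k = stage X g k"
proof -
  have *: "approx f j = approx g j" if "j \<le> k" for j
    using assms that unfolding approx_def by auto
  have "left_pt f k = left_pt g k" "right_pt f k = right_pt g k" "f 1 = g 1"
    using assms[of 1] * unfolding left_pt_def right_pt_def by auto
  moreover have "(\<forall>j<k. \<forall>l<j. X (query 0 0 j (approx f j l) (approx f k l))) \<longleftrightarrow>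
      (\<forall>j<k. \<forall>l<j. X (query 0 0 j (approx g j l) (approx g k l)))"
    using * by simp
  ultimately show ?thesis
    unfolding stage_def by (simp only:)
qed

text \<open>Stage \<open>k\<close> is tested as soon as entry \<open>k + 2\<close> is present. All
  lists of length at most 2 are therefore nodes, and \<open>c\<close> can be chosen freely.\<close>

definition approx_tree :: "(nat \<Rightarrow> bool) \<Rightarrow> nat list set" where
  "approx_tree X = {s. \<forall>k. k + 2 < length s \<longrightarrow> stage X ((!) s) k}"

lemma approx_tree_snoc:
  "s @ [x] \<in> approx_tree X \<longleftrightarrow>
     s \<in> approx_tree X \<and> (2 \<le> length s \<longrightarrow> stage X ((!) (s @ [x])) (length s - 2))"
proof -
  have "stage X ((!) (s @ [x])) k = stage X ((!) s) k" if "k + 2 < length s" for k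
    by (rule stage_cong) (use that in \<open>auto simp: nth_append\<close>)
  moreover have "k + 2 < length (s @ [x]) \<longleftrightarrow> k + 2 < length s \<or> (2 \<le> length s \<and> k = length s - 2)" for k
    by auto
  ultimately show ?thesis
    unfolding approx_tree_def mem_Collect_eq by metis
qed

lemma approx_tree_branch:
  assumes "\<And>n. map f [0..<n] \<in> approx_tree X"
  shows "stage X f k"
proof -
  have "stage X ((!) (map f [0..<k + 3])) k"
    using assms[of "k + 3"] unfolding approx_tree_def by simp
  then show ?thesis
    by (subst stage_cong[where g = "(!) (map f [0..<k + 3])"]) auto
qed

text \<open>All quantifiers in \<open>stage\<close> are bounded, and its atoms are oracle queries at
  computable arguments.\<close>

lemma comp_pred_stage:
  assumes "comp_fun X g" "comp_fun X h"
  shows "comp_pred X (\<lambda>x. stage X (nth_code (g x)) (h x))"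
  unfolding stage_def left_pt_def right_pt_def approx_def query_def
  by (intro comp_intros comp_fun_comp[OF assms(1)] comp_fun_comp[OF assms(2)])

lemma list_decode_in_approx_tree:
  "list_decode x \<in> approx_tree X \<longleftrightarrow> (\<forall>k<len_code x - 2. stage X (nth_code x) k)"
proof -
  have "stage X ((!) (list_decode x)) k = stage X (nth_code x) k" if "k + 2 < length (list_decode x)" for k
    by (rule stage_cong) (use that nth_code[of _ "list_decode x"] in auto)
  moreover have "k + 2 < length (list_decode x) \<longleftrightarrow> k < len_code x - 2" for k
    using len_code[of "list_decode x"] by auto
  ultimately show ?thesis
    unfolding approx_tree_def by auto
qed

lemma list_decode_in_kb_less:
  "(list_decode x, list_decode y) \<in> kb_less \<longleftrightarrow>
    (len_code y < len_code x \<and> (\<forall>i<len_code y. nth_code x i = nth_code y i)) \<or>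
    (\<exists>i<len_code y. i < len_code x \<and> (\<forall>j<i. nth_code x j = nth_code y j) \<and> nth_code x i < nth_code y i)"
proof -
  have "len_code z = length (list_decode z)" "i < length (list_decode z) \<Longrightarrow> nth_code z i = list_decode z ! i" for z i
    using len_code[of "list_decode z"] nth_code[of _ "list_decode z"] by auto
  then show ?thesis
    unfolding kb_less_iff by auto
qed

lemma computable_kb_order: "computable_in X (kb_order (approx_tree X))"
proof (rule computable_inI)
  show "comp_pred X (\<lambda>z. (pfst z, psnd z) \<in> kb_order (approx_tree X))"
    unfolding kb_order_def mem_Collect_eq case_prod_conv list_decode_in_approx_tree list_decode_in_kb_less
    by (intro comp_intros comp_pred_stage)
qed

section \<open>Automorphisms from branches\<close>

lemma dense_sequence:
  fixes a :: "nat \<Rightarrow> 'a::metric_space"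
  assumes "closure (range a) = UNIV"
  obtains i where "(\<lambda>n. a (i n)) \<longlonglongrightarrow> x"
proof -
  obtain \<sigma> where \<sigma>: "\<And>n. \<sigma> n \<in> range a" "\<sigma> \<longlonglongrightarrow> x"
    using assms closure_sequential[of x "range a"] by auto
  then have "\<forall>n. \<exists>i. \<sigma> n = a i" by blast
  then obtain i where "\<And>n. \<sigma> n = a (i n)" by metis
  then have "\<sigma> = (\<lambda>n. a (i n))" by blast
  with \<sigma>(2) that show thesis by blast
qed

text \<open>If \<open>a (i n)\<close> tends to \<open>x\<close>, then \<open>b (i n)\<close> is
  Cauchy because it has the same mutual distances; its limit is the required point.\<close>

lemma isometry_extends:
  fixes a b :: "nat \<Rightarrow> 'a::metric_space"
  assumes complete: "complete (UNIV :: 'a set)" and dense: "closure (range a) = UNIV"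
    and iso: "\<And>i j. dist (a i) (a j) = dist (b i) (b j)"
  shows "\<exists>y. \<forall>i. dist y (b i) = dist x (a i)"
proof -
  obtain i where i: "(\<lambda>n. a (i n)) \<longlonglongrightarrow> x"
    using dense_sequence[OF dense] .
  then have "Cauchy (\<lambda>n. a (i n))"
    using LIMSEQ_imp_Cauchy by blast
  then have "Cauchy (\<lambda>n. b (i n))"
    unfolding Cauchy_def iso .
  then obtain y where y: "(\<lambda>n. b (i n)) \<longlonglongrightarrow> y"
    using complete unfolding complete_def by blast
  have "dist y (b j) = dist x (a j)" for j
  proof (rule LIMSEQ_unique)
    show "(\<lambda>n. dist (b (i n)) (b j)) \<longlonglongrightarrow> dist y (b j)"
      by (intro tendsto_intros y)
    show "(\<lambda>n. dist (b (i n)) (b j)) \<longlonglongrightarrow> dist x (a j)"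
      unfolding iso[symmetric] by (intro tendsto_intros i)
  qed
  then show ?thesis by blast
qed

lemma dist_dense_unique:
  fixes y z :: "'a::metric_space"
  assumes "closure (range b) = UNIV" "\<And>i. dist y (b i) = dist z (b i)"
  shows "y = z"
proof (rule ccontr)
  assume "y \<noteq> z"
  then obtain i where "dist (b i) y < dist y z / 2"
    using assms(1) closure_approachable[of y "range b"] by (auto dest: spec[of _ "dist y z / 2"])
  then show False
    using assms(2)[of i] dist_triangle_half_l[of y "b i" "dist y z" z] by (simp add: dist_commute)
qed

text \<open>Distances to a dense sequence determine a point. Both compositions of the extensions
  \<open>g\<close> and \<open>h\<close> preserve these distances, so \<open>g\<close> and
  \<open>h\<close> are inverse to each other.\<close>

lemma dense_isometry_bij:
  fixes a b :: "nat \<Rightarrow> 'a::metric_space"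
  assumes complete: "complete (UNIV :: 'a set)"
    and dense: "closure (range a) = UNIV" "closure (range b) = UNIV"
    and iso: "\<And>i j. dist (a i) (a j) = dist (b i) (b j)"
  obtains g where "bij g" "\<And>x y. dist (g x) (g y) = dist x y" "\<And>i. g (a i) = b i"
proof -
  obtain g where g: "\<And>x i. dist (g x) (b i) = dist x (a i)"
    using isometry_extends[OF complete dense(1) iso] by metis
  obtain h where h: "\<And>y i. dist (h y) (a i) = dist y (b i)"
    using isometry_extends[OF complete dense(2) iso[symmetric]] by metis
  have "g (h y) = y" for y
    by (rule dist_dense_unique[OF dense(2)]) (simp add: g h)
  moreover have "h (g x) = x" for x
    by (rule dist_dense_unique[OF dense(1)]) (simp add: g h)
  ultimately have "bij g"
    by (metis bijI')
  moreover have ga: "g (a i) = b i" for i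
    by (rule dist_dense_unique[OF dense(2)]) (simp add: g iso)
  moreover have "dist (g x) (g y) = dist x y" for x y
  proof -
    obtain i where i: "(\<lambda>n. a (i n)) \<longlonglongrightarrow> y"
      using dense_sequence[OF dense(1)] .
    \<comment> \<open>The distance from \<open>b (i n)\<close> to \<open>g y\<close> equals that
      from \<open>a (i n)\<close> to \<open>y\<close>, which tends to 0.\<close>
    have "(\<lambda>n. b (i n)) \<longlonglongrightarrow> g y"
      using i unfolding tendsto_dist_iff[of _ y] tendsto_dist_iff[of _ "g y"]
      by (simp add: g dist_commute[of "b _"] dist_commute[of "a _"])
    then have "(\<lambda>n. dist (g x) (b (i n))) \<longlonglongrightarrow> dist (g x) (g y)"
      by (intro tendsto_intros)
    moreover have "(\<lambda>n. dist (g x) (b (i n))) \<longlonglongrightarrow> dist x y"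
      unfolding g by (intro tendsto_intros i)
    ultimately show ?thesis
      by (rule LIMSEQ_unique)
  qed
  ultimately show thesis
    using that by blast
qed

lemma branch_imp_not_rigid:
  fixes d :: "nat \<Rightarrow> nat \<Rightarrow> real" and e :: "nat \<Rightarrow> 'a::metric_space"
  assumes e: "\<And>m n. dist (e m) (e n) = d m n" and dense: "closure (range e) = (UNIV :: 'a set)"
    and complete: "complete (UNIV :: 'a set)" and stage: "\<And>k. stage (metric_code d) f k"
  shows "\<not> U_rigid TYPE('a)"
proof -
  note st = stage[unfolded stage_def metric_code_query, folded e]
  have conv: "\<exists>z. (\<lambda>k. e (approx f k l)) \<longlonglongrightarrow> z" for l
  proof -
    have "Cauchy (\<lambda>k. e (approx f k l))"
    proof (rule metric_CauchyI)
      fix \<epsilon> :: real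
      assume "0 < \<epsilon>"
      then obtain n where n: "inverse (real (Suc n)) < \<epsilon>"
        using reals_Archimedean by blast
      have less: "dist (e (approx f j l)) (e (approx f k l)) < \<epsilon>" if "max (Suc l) n \<le> j" "j < k" for j k
      proof -
        have "dist (e (approx f j l)) (e (approx f k l)) < 1 / real (Suc j)"
          using conjunct1[OF st, of k] that by auto
        also have "\<dots> \<le> inverse (real (Suc n))"
          using that by (simp add: field_simps)
        finally show ?thesis using n by simp
      qed
      show "\<exists>N. \<forall>j\<ge>N. \<forall>k\<ge>N. dist (e (approx f j l)) (e (approx f k l)) < \<epsilon>"
      proof (intro exI allI impI)
        fix j k
        assume "max (Suc l) n \<le> j" "max (Suc l) n \<le> k"
        then show "dist (e (approx f j l)) (e (approx f k l)) < \<epsilon>"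
          using less[of j k] less[of k j] \<open>0 < \<epsilon>\<close> by (cases j k rule: linorder_cases) (auto simp: dist_commute)
      qed
    qed
    then show ?thesis
      using complete unfolding complete_def by blast
  qed
  then obtain z where z: "\<And>l. (\<lambda>k. e (approx f k l)) \<longlonglongrightarrow> z l" by metis
  define a where "a l = (if pfst l = 0 then e (psnd l) else z l)" for l
  define b where "b l = (if pfst l = 0 then z l else e (psnd l))" for l
  have a: "(\<lambda>k. e (left_pt f k l)) \<longlonglongrightarrow> a l" and b: "(\<lambda>k. e (right_pt f k l)) \<longlonglongrightarrow> b l" for l
    using z[of l] unfolding left_pt_def right_pt_def a_def b_def by simp_all
  \<comment> \<open>If \<open>u < v\<close>, a fine enough grid has two neighbours
    \<open>(p + 1) / (r + 1)\<close> and \<open>(p + 2) / (r + 1)\<close> strictly between them, and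
    the approximating distances eventually violate the test.\<close>
  have limit_le: "u \<ge> v"
    if "\<And>k. (\<lambda>k. dist (e (P k)) (e (P' k))) \<longlonglongrightarrow> u" "\<And>k. (\<lambda>k. dist (e (Q k)) (e (Q' k))) \<longlonglongrightarrow> v"
      "\<And>p r k. \<lbrakk>p < k; r < k; n < k; dist (e (P k)) (e (P' k)) < real (Suc p) / real (Suc r);
        real (Suc (Suc p)) / real (Suc r) < dist (e (Q k)) (e (Q' k))\<rbrakk> \<Longrightarrow> False"
    for u v n and P P' Q Q' :: "nat \<Rightarrow> nat"
  proof (rule ccontr)
    assume "\<not> v \<le> u"
    then have uv: "u < v" by simp
    have u: "0 \<le> u"
      using that(1) by (rule LIMSEQ_le_const) simp
    obtain r where r: "inverse (real (Suc r)) < (v - u) / 2"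
      using reals_Archimedean[of "(v - u) / 2"] uv by auto
    define p where "p = nat \<lfloor>u * real (Suc r)\<rfloor>"
    have p: "real p \<le> u * real (Suc r)" "u * real (Suc r) < real (Suc p)"
      unfolding p_def using u by (simp_all add: of_nat_floor) linarith
    have 1: "u < real (Suc p) / real (Suc r)"
      using p by (simp add: field_simps)
    have "real (Suc (Suc p)) / real (Suc r) = real p / real (Suc r) + 2 * inverse (real (Suc r))"
      by (simp add: add_divide_distrib divide_inverse algebra_simps)
    also have "\<dots> \<le> u + 2 * inverse (real (Suc r))"
      using p(1) by (simp add: divide_le_eq del: of_nat_Suc)
    finally have "real (Suc (Suc p)) / real (Suc r) \<le> u + 2 * inverse (real (Suc r))" .
    then have 2: "real (Suc (Suc p)) / real (Suc r) < v"
      using r by simp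
    have "\<forall>\<^sub>F k in sequentially. dist (e (P k)) (e (P' k)) < real (Suc p) / real (Suc r) \<and>
        real (Suc (Suc p)) / real (Suc r) < dist (e (Q k)) (e (Q' k)) \<and> max n (max p r) < k"
      using order_tendstoD(2)[OF that(1) 1] order_tendstoD(1)[OF that(2) 2] eventually_gt_at_top
      by (intro eventually_conj)
    then obtain k where "dist (e (P k)) (e (P' k)) < real (Suc p) / real (Suc r)"
        "real (Suc (Suc p)) / real (Suc r) < dist (e (Q k)) (e (Q' k))" "max n (max p r) < k"
      by (auto simp: eventually_sequentially)
    then show False
      using that(3)[of p k r] by auto
  qed
  have iso: "dist (a i) (a j) = dist (b i) (b j)" for i j
  proof (rule antisym)
    show "dist (a i) (a j) \<le> dist (b i) (b j)"
      by (rule limit_le[where n = "max i j", OF tendsto_dist[OF b b] tendsto_dist[OF a a]])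
        (use st in auto)
    show "dist (b i) (b j) \<le> dist (a i) (a j)"
      by (rule limit_le[where n = "max i j", OF tendsto_dist[OF a a] tendsto_dist[OF b b]])
        (use st in auto)
  qed
  \<comment> \<open>Indices \<open>pr 0 i\<close> put every dense point on the left, indices
    \<open>pr 1 i\<close> on the right, so both families are dense.\<close>
  have "e i = a (pr 0 i)" "e i = b (pr 1 i)" for i
    by (simp_all add: a_def b_def)
  then have "range e \<subseteq> range a" "range e \<subseteq> range b"
    by (metis image_subsetI rangeI)+
  then have ab: "closure (range a) = UNIV" "closure (range b) = UNIV"
    using dense closure_mono by (metis top.extremum_uniqueI)+
  obtain g where g: "bij g" "\<And>x y. dist (g x) (g y) = dist x y" "\<And>i. g (a i) = b i"
    using dense_isometry_bij[OF complete ab iso] by blast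
  have "U_automorphism g"
    unfolding U_automorphism_def using g by simp
  moreover have "g \<noteq> id"
  proof
    assume "g = id"
    define l where "l = pfst (f 1)"
    have "a l = b l"
      using g(3)[of l] \<open>g = id\<close> by simp
    \<comment> \<open>The strict bound in the last clause of \<open>stage\<close> becomes weak in
      the limit, but stays positive.\<close>
    moreover have "1 / real (Suc (psnd (f 1))) \<le> dist (a l) (b l)"
    proof (rule LIMSEQ_le_const[OF tendsto_dist[OF a b]], intro exI allI impI)
      fix k
      assume "Suc (max l (psnd (f 1))) \<le> k"
      then show "1 / real (Suc (psnd (f 1))) \<le> dist (e (left_pt f k l)) (e (right_pt f k l))"
        using conjunct2[OF conjunct2[OF st], of k] unfolding l_def by auto
    qed
    ultimately show False by simp
  qed
  ultimately show ?thesis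
    unfolding U_rigid_def by blast
qed

section \<open>Separating distinct tuples\<close>

text \<open>Distances are nonnegative, so positive rationals suffice to separate two different
  ones.\<close>

lemma partial_U_iso_dist:
  assumes "partial_U_iso as bs" "i < length as" "j < length as"
  shows "dist (as ! i) (as ! j) = dist (bs ! i) (bs ! j)"
proof -
  have q: "dist (as ! i) (as ! j) < of_rat q \<longleftrightarrow> dist (bs ! i) (bs ! j) < of_rat q" if "q > 0" for q :: rat
    using assms that unfolding partial_U_iso_def by blast
  have sep: "\<exists>q>0. x < of_rat q \<and> of_rat q < y" if "0 \<le> x" "x < y" for x y :: real
    using of_rat_dense[OF that(2)] that(1) by (meson le_less_trans zero_less_of_rat_iff)
  show ?thesis
    using q sep[of "dist (as ! i) (as ! j)" "dist (bs ! i) (bs ! j)"]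
      sep[of "dist (bs ! i) (bs ! j)" "dist (as ! i) (as ! j)"]
    by (meson less_asym linorder_neqE_linordered_idom zero_le_dist)
qed

text \<open>Errors below \<open>\<epsilon>\<close> at the points change a distance by less than
  \<open>2 * \<epsilon>\<close>, so the two sides differ by less than \<open>4 * \<epsilon>\<close>,
  which is at most a grid step \<open>1 / (r + 1)\<close> for \<open>r < m\<close>. The factor 2 in
  \<open>moved\<close> absorbs the same error.\<close>

lemma stage_realized:
  fixes d :: "nat \<Rightarrow> nat \<Rightarrow> real" and e :: "nat \<Rightarrow> 'a::metric_space"
  assumes e: "\<And>m n. dist (e m) (e n) = d m n"
    and exact: "\<And>l. l < m \<Longrightarrow> (if pfst l = 0 then a l else b l) = e (psnd l)"
    and close: "\<And>k l. k \<le> m \<Longrightarrow> l < k \<Longrightarrow>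
      dist (e (approx f k l)) (if pfst l = 0 then b l else a l) < 1 / (4 * real (Suc k))"
    and iso: "\<And>l l'. l < m \<Longrightarrow> l' < m \<Longrightarrow> dist (a l) (a l') = dist (b l) (b l')"
    and moved: "pfst (f 1) < m \<Longrightarrow> 2 / real (Suc (psnd (f 1))) \<le> dist (a (pfst (f 1))) (b (pfst (f 1)))"
  shows "stage (metric_code d) f m"
proof -
  define \<epsilon> where "\<epsilon> = 1 / (4 * real (Suc m))"
  have \<epsilon>: "4 * \<epsilon> \<le> 1 / real (Suc r)" if "r < m" for r
    using that unfolding \<epsilon>_def by (simp add: field_simps)
  have left: "dist (e (left_pt f m l)) (a l) < \<epsilon>" and right: "dist (e (right_pt f m l)) (b l) < \<epsilon>"
    if "l < m" for l
    using exact[OF that] close[OF order_refl that] unfolding left_pt_def right_pt_def \<epsilon>_def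
    by (auto split: if_splits)
  have quad: "\<bar>dist x y - dist x' y'\<bar> < 2 * \<epsilon>" if "dist x x' < \<epsilon>" "dist y y' < \<epsilon>" for x y x' y' :: 'a
    using that dist_triangle[of x y x'] dist_triangle[of x' y y'] dist_triangle[of x' y' x]
      dist_triangle[of x y' y] dist_commute[of x x'] dist_commute[of y y'] by linarith
  have cauchy: "d (approx f j l) (approx f m l) < real (Suc 0) / real (Suc j)" if "j < m" "l < j" for j l
  proof -
    let ?z = "if pfst l = 0 then b l else a l"
    have "dist (e (approx f j l)) (e (approx f m l)) < 1 / (4 * real (Suc j)) + 1 / (4 * real (Suc m))"
      using close[of j l] close[of m l] that
        dist_triangle2[of "e (approx f j l)" "e (approx f m l)" ?z] by linarith
    also have "\<dots> \<le> 1 / (4 * real (Suc j)) + 1 / (4 * real (Suc j))"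
      using that by (intro add_left_mono divide_left_mono) auto
    also have "\<dots> \<le> 1 / real (Suc j)"
      by (simp add: field_simps)
    finally show ?thesis
      by (simp add: e)
  qed
  have grid: "real (Suc p) / real (Suc r) + 4 * \<epsilon> \<le> real (Suc (Suc p)) / real (Suc r)" if "r < m" for p r
    using \<epsilon>[OF that] by (simp add: add_divide_distrib)
  have iso': "\<bar>d (left_pt f m l) (left_pt f m l') - d (right_pt f m l) (right_pt f m l')\<bar> < 4 * \<epsilon>"
    if "l < m" "l' < m" for l l'
    using quad[OF left[OF that(1)] left[OF that(2)]] quad[OF right[OF that(1)] right[OF that(2)]] iso[OF that]
    unfolding e by linarith
  have "1 / real (Suc (psnd (f 1))) < d (left_pt f m (pfst (f 1))) (right_pt f m (pfst (f 1)))"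
    if "pfst (f 1) < m" "psnd (f 1) < m"
  proof -
    have "4 * \<epsilon> \<le> 1 / real (Suc (psnd (f 1)))" "2 / real (Suc (psnd (f 1))) = 2 * (1 / real (Suc (psnd (f 1))))"
      using \<epsilon>[OF that(2)] by auto
    moreover have "0 < \<epsilon>"
      by (simp add: \<epsilon>_def)
    ultimately show ?thesis
      using quad[OF left[OF that(1)] right[OF that(1)]] moved[OF that(1)] unfolding e by linarith
  qed
  moreover have "\<not> (d (left_pt f m l) (left_pt f m l') < real (Suc p) / real (Suc r) \<and>
        real (Suc (Suc p)) / real (Suc r) < d (right_pt f m l) (right_pt f m l'))"
      "\<not> (d (right_pt f m l) (right_pt f m l') < real (Suc p) / real (Suc r) \<and>
        real (Suc (Suc p)) / real (Suc r) < d (left_pt f m l) (left_pt f m l'))"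
    if "l < m" "l' < m" "r < m" for l l' p r
    using iso'[OF that(1,2)] grid[OF that(3), of p] by linarith+
  ultimately show ?thesis
    unfolding stage_def metric_code_query using cauchy by simp
qed

text \<open>The pairs \<open>(a l, b l)\<close> realize the pairs that the node approximates; a node whose
  last stage is \<open>k\<close> uses only those with \<open>l < k\<close>, so that the child and hence the level of the next
  back-and-forth step can be chosen before the step adds a new pair.\<close>

lemma not_bf_rel_approx_tree:
  fixes d :: "nat \<Rightarrow> nat \<Rightarrow> real" and e :: "nat \<Rightarrow> 'a::metric_space"
  defines "T \<equiv> approx_tree (metric_code d)"
  defines "W \<equiv> kb_order T"
  assumes e: "\<And>m n. dist (e m) (e n) = d m n" and dense: "closure (range e) = (UNIV :: 'a set)"
    and W: "Well_order W" and len: "length bs = length as"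
    and ws: "h # c # ws \<in> T"
    and exact: "\<And>l. l < length ws \<Longrightarrow> (if pfst l = 0 then a l else b l) = e (psnd l)"
    and close: "\<And>k l. k < length ws \<Longrightarrow> l < k \<Longrightarrow>
      dist (e (nth_code (ws ! k) l)) (if pfst l = 0 then b l else a l) < 1 / (4 * real (Suc k))"
    and moved: "\<And>A B. \<lbrakk>partial_U_iso (as @ A) (bs @ B); pfst c < length A;
        A ! pfst c = e (psnd (pfst c)) \<or> pfst (pfst c) \<noteq> 0\<rbrakk>
        \<Longrightarrow> 2 / real (Suc (psnd c)) \<le> dist (A ! pfst c) (B ! pfst c)"
  shows "(as @ map a [0..<length ws], bs @ map b [0..<length ws]) \<notin> bf_rel W (list_encode (h # c # ws))"
proof -
  \<comment> \<open>A descent along \<open>W\<close>: an equivalence at a node yields one at a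
    child, with one more pair. \<open>h\<close>, \<open>c\<close>, \<open>as\<close> and
    \<open>bs\<close> stay fixed.\<close>
  have "x = list_encode (h # c # ws) \<Longrightarrow> ?thesis" for x
    using ws exact close
  proof (induction x arbitrary: ws a b rule: below_induct[OF W])
    case (1 x)
    define m where "m = length ws"
    let ?z = "\<lambda>l. if pfst l = 0 then b l else a l"
    show ?case
    proof
      assume bf: "(as @ map a [0..<length ws], bs @ map b [0..<length ws]) \<in> bf_rel W (list_encode (h # c # ws))"
      have iso: "partial_U_iso (as @ map a [0..<m]) (bs @ map b [0..<m])"
        using bf_rel_partial_U_iso[OF W bf] unfolding m_def .
      have "\<exists>i. dist (e i) (?z l) < 1 / (4 * real (Suc m))" for l
        using dense closure_approachable[of "?z l" "range e"] by (auto simp del: of_nat_Suc)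
      then obtain u where u: "\<And>l. dist (e (u l)) (?z l) < 1 / (4 * real (Suc m))"
        by metis
      define w where "w = list_encode (map u [0..<m])"
      have w: "nth_code w l = u l" if "l < m" for l
        unfolding w_def using that by (subst nth_code) auto
      define s where "s = h # c # ws @ [w]"
      have "stage (metric_code d) ((!) s) m"
      proof (rule stage_realized[OF e, where a = a and b = b])
        show "(if pfst l = 0 then a l else b l) = e (psnd l)" if "l < m" for l
          using 1(4) that unfolding m_def by blast
        show "dist (e (approx ((!) s) k l)) (?z l) < 1 / (4 * real (Suc k))" if "k \<le> m" "l < k" for k l
        proof (cases "k = m")
          case True
          then show ?thesis
            using u[of l] w[of l] that by (simp add: approx_def s_def nth_append m_def)
        next
          case False
          then show ?thesis
            using 1(5)[of k l] that by (simp add: approx_def s_def nth_append m_def)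
        qed
        show "dist (a l) (a l') = dist (b l) (b l')" if "l < m" "l' < m" for l l'
          using partial_U_iso_dist[OF iso, of "length as + l" "length as + l'"] that len
          by (simp add: nth_append)
        show "2 / real (Suc (psnd (s ! 1))) \<le> dist (a (pfst (s ! 1))) (b (pfst (s ! 1)))"
          if "pfst (s ! 1) < m"
          using moved[OF iso] 1(4)[of "pfst c"] that by (auto simp: s_def m_def split: if_splits)
      qed
      then have s: "s \<in> T"
        using 1(3) approx_tree_snoc[of "h # c # ws" w] unfolding T_def s_def m_def by simp
      have "(s, h # c # ws) \<in> kb_less"
        using kb_less_append[of "[w]" "h # c # ws"] unfolding s_def by simp
      moreover have "list_encode s \<noteq> x"
        unfolding 1(2) s_def by (simp only: list_encode_eq) simp
      ultimately have below: "(list_encode s, x) \<in> W \<and> list_encode s \<noteq> x"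
        using s 1(3) unfolding W_def kb_order_def 1(2) by simp
      then have "(as @ map a [0..<m], bs @ map b [0..<m]) \<in> back_forth (bf_rel W (list_encode s))"
        using bf_rel_back_forth[OF W] bf unfolding 1(2) m_def by blast
      \<comment> \<open>For \<open>pfst m = 0\<close> the forth clause is applied to the dense point
        \<open>e (psnd m)\<close>, otherwise the back clause.\<close>
      then obtain a' b' where ab: "(as @ map a [0..<m] @ [a'], bs @ map b [0..<m] @ [b']) \<in> bf_rel W (list_encode s)"
        and e': "(if pfst m = 0 then a' else b') = e (psnd m)"
        unfolding back_forth_def by (cases "pfst m = 0") fastforce+
      have "(as @ map (a(m := a')) [0..<length (ws @ [w])], bs @ map (b(m := b')) [0..<length (ws @ [w])])
          \<notin> bf_rel W (list_encode (h # c # ws @ [w]))"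
      proof (rule 1(1))
        show "(list_encode s, x) \<in> W \<and> list_encode s \<noteq> x"
          by (rule below)
        show "list_encode s = list_encode (h # c # ws @ [w])" "h # c # ws @ [w] \<in> T"
          using s by (simp_all add: s_def)
        show "(if pfst l = 0 then (a(m := a')) l else (b(m := b')) l) = e (psnd l)"
          if "l < length (ws @ [w])" for l
          using that e' 1(4)[of l] by (auto simp: m_def less_Suc_eq)
        \<comment> \<open>Since \<open>l < k\<close> and \<open>k\<close> is at most
          \<open>m\<close>, the values updated at \<open>m\<close> do not occur. For
          \<open>k = m\<close> the entry is \<open>w\<close>, chosen with exactly this
          tolerance.\<close>
        show "dist (e (nth_code ((ws @ [w]) ! k) l)) (if pfst l = 0 then (b(m := b')) l else (a(m := a')) l)
            < 1 / (4 * real (Suc k))"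
          if "k < length (ws @ [w])" "l < k" for k l
        proof (cases "k = m")
          case True
          then show ?thesis
            using u[of l] w[of l] that by (auto simp: nth_append m_def split: if_splits)
        next
          case False
          then show ?thesis
            using 1(5)[of k l] that by (auto simp: nth_append m_def split: if_splits)
        qed
      qed
      moreover have "map (a(m := a')) [0..<length (ws @ [w])] = map a [0..<m] @ [a']"
        "map (b(m := b')) [0..<length (ws @ [w])] = map b [0..<m] @ [b']"
        by (simp_all add: m_def)
      ultimately show False
        using ab unfolding s_def by simp
    qed
  qed
  then show ?thesis by blast
qed

theorem theorem6p2:
  fixes d :: "nat \<Rightarrow> nat \<Rightarrow> real"
    and e :: "nat \<Rightarrow> 'a::metric_space"
  assumes "Metric_space (UNIV :: nat set) d"
    and "\<And>m n. dist (e m) (e n) = d m n"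
    and "closure (range e) = (UNIV :: 'a set)"
    and "complete (UNIV :: 'a set)"
    and "U_rigid TYPE('a)"
  shows "SR_below_omega1 TYPE('a) (metric_code d)"
proof -
  note e = assms(2) and dense = assms(3)
  define T where "T = approx_tree (metric_code d)"
  define W where "W = kb_order T"
  \<comment> \<open>The level of \<open>root\<close> will bound the rank of every tuple; the empty
    node above it accounts for the \<open>+ 1\<close> in the rank of the structure.\<close>
  define root where "root = list_encode [0]"
  have "\<forall>f. \<exists>n. map f [0..<n] \<notin> T"
    using branch_imp_not_rigid[OF e dense assms(4)] assms(5) approx_tree_branch unfolding T_def by blast
  then have W: "Well_order W"
    unfolding W_def by (intro Well_order_kb_order) (simp_all add: T_def approx_tree_snoc)
  have T: "s \<in> T" if "length s \<le> 2" for s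
    using that unfolding T_def approx_tree_def by simp
  have top: "list_encode [] \<in> Field W" "(root, list_encode []) \<in> W" "root \<noteq> list_encode []"
    unfolding W_def Field_kb_order root_def using T kb_less_append[of "[0]" "[]"]
    by (simp_all add: kb_order_def list_encode_eq del: list_encode.simps)
  have "(as, bs) \<notin> bf_rel W root" if len: "length bs = length as" and neq: "as \<noteq> bs" for as bs :: "'a list"
  proof
    assume bf: "(as, bs) \<in> bf_rel W root"
    obtain q where q: "q < length as" "as ! q \<noteq> bs ! q"
      using len neq by (metis list_eq_iff_nth_eq)
    define D where "D = dist (as ! q) (bs ! q)"
    have "0 < D"
      using q unfolding D_def by simp
    \<comment> \<open>A map that takes \<open>as ! q\<close> to \<open>bs ! q\<close> and preserves
      distances sends \<open>e p\<close> within \<open>D / 4\<close> of \<open>bs ! q\<close>. So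
      \<open>e p\<close> moves by more than \<open>D / 2\<close>, which exceeds
      \<open>2 / (r + 1)\<close> for the \<open>r\<close> chosen next.\<close>
    obtain p where p: "dist (e p) (as ! q) < D / 4"
      using dense closure_approachable[of "as ! q" "range e"] \<open>0 < D\<close> by (auto dest!: spec[of _ "D / 4"])
    obtain r where r: "inverse (real (Suc r)) < D / 4"
      using reals_Archimedean[of "D / 4"] \<open>0 < D\<close> by auto
    define c where "c = pr (pr 0 p) r"
    have "below W (list_encode [0, c]) root"
      unfolding W_def root_def kb_order_def using T kb_less_append[of "[c]" "[0]"]
      by (simp add: list_encode_eq del: list_encode.simps)
    \<comment> \<open>The node \<open>[0, c]\<close> has no stages, so the lists of added pairs are
      empty.\<close>
    then have "(as @ map undefined [0..<length []], bs @ map undefined [0..<length []]) \<in> bf_rel W (list_encode (0 # c # []))"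
      using bf_rel_antimono[OF W] bf by auto
    moreover have "2 / real (Suc (psnd c)) \<le> dist (A ! pfst c) (B ! pfst c)"
      if iso: "partial_U_iso (as @ A) (bs @ B)" and A: "pfst c < length A" "A ! pfst c = e (psnd (pfst c)) \<or> pfst (pfst c) \<noteq> 0" for A B
    proof -
      have "dist (A ! pfst c) (as ! q) = dist (B ! pfst c) (bs ! q)"
        using partial_U_iso_dist[OF iso, of "length as + pfst c" q] A q(1) len by (simp add: nth_append)
      moreover have "A ! pfst c = e p"
        using A(2) by (simp add: c_def)
      ultimately have "D / 2 < dist (A ! pfst c) (B ! pfst c)"
        using p dist_triangle[of "as ! q" "bs ! q" "e p"] dist_triangle[of "e p" "bs ! q" "B ! pfst c"]
          dist_commute[of "e p" "as ! q"] unfolding D_def by simp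
      moreover have "2 / real (Suc (psnd c)) < D / 2"
        using r by (simp add: c_def field_simps)
      ultimately show ?thesis by simp
    qed
    ultimately show False
      using not_bf_rel_approx_tree[OF e dense, where ws = "[]" and h = 0 and c = c and as = as and bs = bs] W len T[of "[0, c]"]
      unfolding W_def T_def by fastforce
  qed
  \<comment> \<open>Equal tuples are equivalent at every level, so only distinct ones enter the
    supremum.\<close>
  moreover have "as \<noteq> bs" if "SR_pair_finite as bs" for as bs :: "'a list"
    using that unfolding SR_pair_finite_def by (auto simp: bf_rel_refl)
  moreover have "(root, root) \<in> W"
    unfolding W_def kb_order_def root_def using T by simp
  ultimately have "SR_structure_le TYPE('a) W (list_encode [])"
    unfolding SR_structure_le_def SR_tuple_le_def using top by blast
  then show ?thesis
    unfolding SR_below_omega1_def using W top computable_kb_order unfolding W_def T_def by blast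
qed

end
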